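(* Suppose that $F$ is $\zeta$-bounded and preserves monomorphisms. Let $R$ be a relational connector of $F$. If $R$-similarity is sound, then $R$ is normal.
   Context: $F\colon\mathbf{Set}\to\mathbf{Set}$ is a functor. Relations $r\subseteq X\times Y$ are composed applicatively, $r^\circ$ is the converse, functions are regarded as relations, $1_X$ is the identity relation. An $F$-relator $R$ is a monotone assignment of $Rr\subseteq FX\times FY$ to each $r\subseteq X\times Y$; it is normal if $R1_X=1_{FX}$ for all $X$. $R$ is a relational connector if $1_{FX}\le R1_X$ for every set $X$ and $R(g^\circ\cdot r\cdot f)=(Fg)^\circ\cdot Rr\cdot Ff$ for all relations $r\subseteq X\times Y$ and functions $f\colon A\to X$, $g\colon B\to Y$. Given coalgebras $\alpha\colon X\to FX$, $\beta\colon Y\to FY$, $r\subseteq X\times Y$ is an $R$-simulation if $r\le\beta^\circ\cdot Rr\cdot\alpha$; $R$-similarity (the greatest $R$-simulation) is sound if it is always contained in behavioural equivalence (states identified by some pair of coalgebra morphisms into a common coalgebra). $F$ is $\zeta$-bounded if it admits a terminal coalgebra $Z\to FZ$ and for every set $X$ and all $u,v\in FX$ there are a set $A$ with $|A|\le|Z|$ and an injective map $i\colon A\to X$ with $u,v$ in the image of $Fi$. *)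

theory Defs
  imports "HOL-Library.FuncSet" "HOL-Library.Equipollence"
begin

text \<open>
  Since HOL has no type of all sets, the category of sets is represented by a universe
  \<open>U :: 'u set set\<close>: its objects are the members of \<open>U\<close> (the ``small'' sets) and the morphisms
  from \<open>X\<close> to \<open>Y\<close> are all functions, i.e. the elements of \<open>X \<rightarrow>\<^sub>E Y\<close>, which are determined by their
  values on \<open>X\<close>. Both the type \<open>'u\<close> and the collection \<open>U\<close> are arbitrary; in particular \<open>U\<close> may be
  a Grothendieck universe, or \<open>UNIV\<close>. No closure property of \<open>U\<close> is needed below, and requiring
  any would only restrict the choice of \<open>U\<close>.
\<close>

text \<open>
  The action \<open>Fm X Y f\<close> of a functor on \<open>f : X \<rightarrow> Y\<close> takes the domain and codomain as arguments,
  because they are part of a morphism but cannot be recovered from the HOL function \<open>f\<close>.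
  In \<^term>\<open>compose X g f\<close>, which is \<open>g \<circ> f\<close> on \<open>X\<close>, the set \<open>X\<close> is the domain of \<open>f\<close>.
\<close>

type_synonym 'u mor = "'u \<Rightarrow> 'u"
type_synonym 'u obj_map = "'u set \<Rightarrow> 'u set"
type_synonym 'u mor_map = "'u set \<Rightarrow> 'u set \<Rightarrow> 'u mor \<Rightarrow> 'u mor"

definition set_functor :: "'u set set \<Rightarrow> 'u obj_map \<Rightarrow> 'u mor_map \<Rightarrow> bool" where
  "set_functor U F Fm \<longleftrightarrow>
     (\<forall>X\<in>U. F X \<in> U) \<and>
     (\<forall>X\<in>U. \<forall>Y\<in>U. \<forall>f \<in> X \<rightarrow>\<^sub>E Y. Fm X Y f \<in> F X \<rightarrow>\<^sub>E F Y) \<and>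
     (\<forall>X\<in>U. Fm X X (\<lambda>x\<in>X. x) = (\<lambda>u\<in>F X. u)) \<and>
     (\<forall>X\<in>U. \<forall>Y\<in>U. \<forall>Z\<in>U. \<forall>f \<in> X \<rightarrow>\<^sub>E Y. \<forall>g \<in> Y \<rightarrow>\<^sub>E Z.
        Fm X Z (compose X g f) = compose (F X) (Fm Y Z g) (Fm X Y f))"

definition mono_mor :: "'u set set \<Rightarrow> 'u set \<Rightarrow> 'u set \<Rightarrow> 'u mor \<Rightarrow> bool" where
  "mono_mor U X Y f \<longleftrightarrow> f \<in> X \<rightarrow>\<^sub>E Y \<and>
     (\<forall>W\<in>U. \<forall>g \<in> W \<rightarrow>\<^sub>E X. \<forall>h \<in> W \<rightarrow>\<^sub>E X. compose W f g = compose W f h \<longrightarrow> g = h)"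

definition preserves_monos :: "'u set set \<Rightarrow> 'u obj_map \<Rightarrow> 'u mor_map \<Rightarrow> bool" where
  "preserves_monos U F Fm \<longleftrightarrow>
     (\<forall>X\<in>U. \<forall>Y\<in>U. \<forall>f. mono_mor U X Y f \<longrightarrow> mono_mor U (F X) (F Y) (Fm X Y f))"

definition coalgebra :: "'u set set \<Rightarrow> 'u obj_map \<Rightarrow> 'u set \<Rightarrow> 'u mor \<Rightarrow> bool" where
  "coalgebra U F X \<alpha> \<longleftrightarrow> X \<in> U \<and> \<alpha> \<in> X \<rightarrow>\<^sub>E F X"

definition coalg_mor ::
  "'u obj_map \<Rightarrow> 'u mor_map \<Rightarrow> 'u set \<Rightarrow> 'u mor \<Rightarrow> 'u set \<Rightarrow> 'u mor \<Rightarrow> 'u mor \<Rightarrow> bool" where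
  "coalg_mor F Fm X \<alpha> Y \<beta> f \<longleftrightarrow> f \<in> X \<rightarrow>\<^sub>E Y \<and> compose X \<beta> f = compose X (Fm X Y f) \<alpha>"

definition terminal_coalgebra ::
  "'u set set \<Rightarrow> 'u obj_map \<Rightarrow> 'u mor_map \<Rightarrow> 'u set \<Rightarrow> 'u mor \<Rightarrow> bool" where
  "terminal_coalgebra U F Fm Z \<zeta> \<longleftrightarrow> coalgebra U F Z \<zeta> \<and>
     (\<forall>X \<alpha>. coalgebra U F X \<alpha> \<longrightarrow> (\<exists>!f. coalg_mor F Fm X \<alpha> Z \<zeta> f))"

definition zeta_bounded :: "'u set set \<Rightarrow> 'u obj_map \<Rightarrow> 'u mor_map \<Rightarrow> bool" where
  "zeta_bounded U F Fm \<longleftrightarrow>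
     (\<exists>Z \<zeta>. terminal_coalgebra U F Fm Z \<zeta> \<and>
        (\<forall>X\<in>U. \<forall>u \<in> F X. \<forall>v \<in> F X.
           \<exists>A\<in>U. A \<lesssim> Z \<and> (\<exists>i \<in> A \<rightarrow>\<^sub>E X. inj_on i A \<and> {u, v} \<subseteq> Fm A X i ` F A)))"

definition beh_equiv ::
  "'u set set \<Rightarrow> 'u obj_map \<Rightarrow> 'u mor_map \<Rightarrow> 'u set \<Rightarrow> 'u mor \<Rightarrow> 'u set \<Rightarrow> 'u mor \<Rightarrow> 'u rel" where
  "beh_equiv U F Fm X \<alpha> Y \<beta> =
     {(x, y) \<in> X \<times> Y. \<exists>C \<gamma> f g. coalgebra U F C \<gamma> \<and>
        coalg_mor F Fm X \<alpha> C \<gamma> f \<and> coalg_mor F Fm Y \<beta> C \<gamma> g \<and> f x = g y}"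

text \<open>
  Relations \<open>r \<subseteq> X \<times> Y\<close> are composed applicatively, i.e. \<open>s \<cdot> r\<close> relates \<open>x\<close> to \<open>z\<close> if \<open>r\<close> relates
  \<open>x\<close> to some \<open>y\<close> that \<open>s\<close> relates to \<open>z\<close>. The graph of \<open>f\<close> on \<open>X\<close> is \<open>Gr X f\<close>, and the identity
  relation on \<open>X\<close> is \<^term>\<open>Id_on X\<close>.
\<close>

abbreviation Gr :: "'u set \<Rightarrow> 'u mor \<Rightarrow> 'u rel" where
  "Gr \<equiv> BNF_Def.Gr"

abbreviation rel_comp :: "'u rel \<Rightarrow> 'u rel \<Rightarrow> 'u rel" (infixr "\<cdot>" 75) where
  "s \<cdot> r \<equiv> r O s"

type_synonym 'u relator = "'u set \<Rightarrow> 'u set \<Rightarrow> 'u rel \<Rightarrow> 'u rel"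

definition is_relator :: "'u set set \<Rightarrow> 'u obj_map \<Rightarrow> 'u relator \<Rightarrow> bool" where
  "is_relator U F R \<longleftrightarrow>
     (\<forall>X\<in>U. \<forall>Y\<in>U. \<forall>r. r \<subseteq> X \<times> Y \<longrightarrow> R X Y r \<subseteq> F X \<times> F Y) \<and>
     (\<forall>X\<in>U. \<forall>Y\<in>U. \<forall>r s. r \<subseteq> s \<and> s \<subseteq> X \<times> Y \<longrightarrow> R X Y r \<subseteq> R X Y s)"

definition normal_relator :: "'u set set \<Rightarrow> 'u obj_map \<Rightarrow> 'u relator \<Rightarrow> bool" where
  "normal_relator U F R \<longleftrightarrow> (\<forall>X\<in>U. R X X (Id_on X) = Id_on (F X))"

definition relational_connector ::
  "'u set set \<Rightarrow> 'u obj_map \<Rightarrow> 'u mor_map \<Rightarrow> 'u relator \<Rightarrow> bool" where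
  "relational_connector U F Fm R \<longleftrightarrow> is_relator U F R \<and>
     (\<forall>X\<in>U. Id_on (F X) \<subseteq> R X X (Id_on X)) \<and>
     (\<forall>X\<in>U. \<forall>Y\<in>U. \<forall>A\<in>U. \<forall>B\<in>U. \<forall>r f g. r \<subseteq> X \<times> Y \<and> f \<in> A \<rightarrow>\<^sub>E X \<and> g \<in> B \<rightarrow>\<^sub>E Y \<longrightarrow>
        R A B ((Gr B g)\<inverse> \<cdot> r \<cdot> Gr A f) =
          (Gr (F B) (Fm B Y g))\<inverse> \<cdot> R X Y r \<cdot> Gr (F A) (Fm A X f))"

definition simulation ::
  "'u relator \<Rightarrow> 'u set \<Rightarrow> 'u mor \<Rightarrow> 'u set \<Rightarrow> 'u mor \<Rightarrow> 'u rel \<Rightarrow> bool" where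
  "simulation R X \<alpha> Y \<beta> r \<longleftrightarrow> r \<subseteq> X \<times> Y \<and> r \<subseteq> (Gr Y \<beta>)\<inverse> \<cdot> R X Y r \<cdot> Gr X \<alpha>"

definition similarity ::
  "'u relator \<Rightarrow> 'u set \<Rightarrow> 'u mor \<Rightarrow> 'u set \<Rightarrow> 'u mor \<Rightarrow> 'u rel" where
  "similarity R X \<alpha> Y \<beta> = \<Union>{r. simulation R X \<alpha> Y \<beta> r}"

lemma similarity_greatest_simulation:
  assumes "is_relator U F R" "X \<in> U" "Y \<in> U"
  shows "simulation R X \<alpha> Y \<beta> (similarity R X \<alpha> Y \<beta>)"
    and "simulation R X \<alpha> Y \<beta> r \<Longrightarrow> r \<subseteq> similarity R X \<alpha> Y \<beta>"
proof -
  let ?S = "similarity R X \<alpha> Y \<beta>"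
  have S: "?S \<subseteq> X \<times> Y"
    by (auto simp: similarity_def simulation_def)
  have "r \<subseteq> (Gr Y \<beta>)\<inverse> \<cdot> R X Y ?S \<cdot> Gr X \<alpha>" if "simulation R X \<alpha> Y \<beta> r" for r
  proof -
    have "r \<subseteq> ?S"
      using that by (auto simp: similarity_def)
    with S assms have "R X Y r \<subseteq> R X Y ?S"
      by (simp add: is_relator_def)
    with that show ?thesis
      unfolding simulation_def by blast
  qed
  with S show "simulation R X \<alpha> Y \<beta> ?S"
    unfolding simulation_def[of R X \<alpha> Y \<beta> ?S] by (subst (2) similarity_def) blast
qed (auto simp: similarity_def)

definition similarity_sound ::
  "'u set set \<Rightarrow> 'u obj_map \<Rightarrow> 'u mor_map \<Rightarrow> 'u relator \<Rightarrow> bool" where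
  "similarity_sound U F Fm R \<longleftrightarrow>
     (\<forall>X \<alpha> Y \<beta>. coalgebra U F X \<alpha> \<and> coalgebra U F Y \<beta> \<longrightarrow>
        similarity R X \<alpha> Y \<beta> \<subseteq> beh_equiv U F Fm X \<alpha> Y \<beta>)"

end

theory Submission
  imports Defs
begin

text \<open>
  Reindexing along an injection does not change the identity relation, so \<open>(u, v) \<in> R 1\<^sub>X\<close> can be
  pulled back to a set of size at most \<open>|Z|\<close> and then pushed forward into \<open>Z\<close>; as \<open>F\<close> preserves
  monomorphisms, it remains to treat \<open>X = Z\<close>. By Lambek's lemma \<open>u = \<zeta> x\<close> and \<open>v = \<zeta> y\<close> for some
  \<open>x\<close> and \<open>y\<close>, and then \<open>1\<^sub>Z \<union> {(x, y)}\<close> is a simulation. By soundness \<open>x\<close> and \<open>y\<close> are behaviourally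
  equivalent, hence equal because \<open>Z\<close> is terminal.
\<close>

lemma set_functor_obj: "set_functor U F Fm \<Longrightarrow> X \<in> U \<Longrightarrow> F X \<in> U"
  by (simp add: set_functor_def)

lemma set_functor_mor:
  "set_functor U F Fm \<Longrightarrow> X \<in> U \<Longrightarrow> Y \<in> U \<Longrightarrow> f \<in> X \<rightarrow>\<^sub>E Y \<Longrightarrow> Fm X Y f \<in> F X \<rightarrow>\<^sub>E F Y"
  by (simp add: set_functor_def)

lemma set_functor_id: "set_functor U F Fm \<Longrightarrow> X \<in> U \<Longrightarrow> Fm X X (\<lambda>x\<in>X. x) = (\<lambda>u\<in>F X. u)"
  by (simp add: set_functor_def)

lemma set_functor_compose:
  "set_functor U F Fm \<Longrightarrow> X \<in> U \<Longrightarrow> Y \<in> U \<Longrightarrow> Z \<in> U \<Longrightarrow> f \<in> X \<rightarrow>\<^sub>E Y \<Longrightarrow> g \<in> Y \<rightarrow>\<^sub>E Z \<Longrightarrow>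
    Fm X Z (compose X g f) = compose (F X) (Fm Y Z g) (Fm X Y f)"
  by (simp add: set_functor_def)

lemma compose_PiE: "f \<in> X \<rightarrow>\<^sub>E Y \<Longrightarrow> g \<in> Y \<rightarrow>\<^sub>E Z \<Longrightarrow> compose X g f \<in> X \<rightarrow>\<^sub>E Z"
  by (auto simp: compose_def)

lemma coalg_mor_apply:
  assumes "coalg_mor F Fm X \<alpha> Y \<beta> f" "x \<in> X"
  shows "\<beta> (f x) = Fm X Y f (\<alpha> x)"
proof -
  from assms(1) have "compose X \<beta> f x = compose X (Fm X Y f) \<alpha> x"
    by (simp add: coalg_mor_def)
  with assms(2) show ?thesis
    by (simp add: compose_eq)
qed

lemma coalg_morI:
  assumes "f \<in> X \<rightarrow>\<^sub>E Y" "\<And>x. x \<in> X \<Longrightarrow> \<beta> (f x) = Fm X Y f (\<alpha> x)"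
  shows "coalg_mor F Fm X \<alpha> Y \<beta> f"
  using assms by (auto simp: coalg_mor_def compose_def intro!: restrict_ext)

lemma coalg_mor_id:
  assumes "set_functor U F Fm" "coalgebra U F X \<alpha>"
  shows "coalg_mor F Fm X \<alpha> X \<alpha> (\<lambda>x\<in>X. x)"
  using assms by (intro coalg_morI) (auto simp: coalgebra_def set_functor_id)

lemma coalg_mor_compose:
  assumes F: "set_functor U F Fm"
    and "coalgebra U F X \<alpha>" "coalgebra U F Y \<beta>" "coalgebra U F Z \<gamma>"
    and f: "coalg_mor F Fm X \<alpha> Y \<beta> f" and g: "coalg_mor F Fm Y \<beta> Z \<gamma> g"
  shows "coalg_mor F Fm X \<alpha> Z \<gamma> (compose X g f)"
proof (rule coalg_morI)
  have U: "X \<in> U" "Y \<in> U" "Z \<in> U" and \<alpha>: "\<alpha> \<in> X \<rightarrow>\<^sub>E F X"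
    using assms by (auto simp: coalgebra_def)
  have fE: "f \<in> X \<rightarrow>\<^sub>E Y" and gE: "g \<in> Y \<rightarrow>\<^sub>E Z"
    using f g by (auto simp: coalg_mor_def)
  then show "compose X g f \<in> X \<rightarrow>\<^sub>E Z"
    by (rule compose_PiE)
  fix x assume x: "x \<in> X"
  then have "\<alpha> x \<in> F X" "f x \<in> Y"
    using \<alpha> fE by auto
  with x show "\<gamma> (compose X g f x) = Fm X Z (compose X g f) (\<alpha> x)"
    by (simp add: set_functor_compose[OF F U fE gE] compose_eq
        coalg_mor_apply[OF f] coalg_mor_apply[OF g])
qed

lemma terminal_coalgebraD:
  assumes "terminal_coalgebra U F Fm Z \<zeta>"
  shows "coalgebra U F Z \<zeta>"
    and "coalgebra U F X \<alpha> \<Longrightarrow> \<exists>f. coalg_mor F Fm X \<alpha> Z \<zeta> f"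
    and "coalgebra U F X \<alpha> \<Longrightarrow> coalg_mor F Fm X \<alpha> Z \<zeta> f \<Longrightarrow> coalg_mor F Fm X \<alpha> Z \<zeta> g \<Longrightarrow> f = g"
  using assms unfolding terminal_coalgebra_def by blast+

lemma terminal_coalgebra_endo:
  assumes "set_functor U F Fm" "terminal_coalgebra U F Fm Z \<zeta>" "coalg_mor F Fm Z \<zeta> Z \<zeta> f"
  shows "f = (\<lambda>z\<in>Z. z)"
  using terminal_coalgebraD(3)[OF assms(2) _ assms(3)] terminal_coalgebraD(1)[OF assms(2)]
    coalg_mor_id[OF assms(1)] by simp

text \<open>This is half of Lambek's lemma. The map \<open>F \<zeta>\<close> makes
  \<open>F Z\<close> a coalgebra, so there is a morphism \<open>h\<close> from it to
  \<open>Z\<close>, and \<open>\<zeta> h = F h F \<zeta> = F (h \<zeta>)\<close>. This is the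
  identity since \<open>h \<zeta>\<close> is an endomorphism of the terminal coalgebra.\<close>

lemma terminal_coalgebra_surj:
  assumes F: "set_functor U F Fm" and Z: "terminal_coalgebra U F Fm Z \<zeta>"
  shows "F Z \<subseteq> \<zeta> ` Z"
proof
  have coalg: "coalgebra U F Z \<zeta>"
    by (rule terminal_coalgebraD[OF Z])
  then have ZU: "Z \<in> U" and \<zeta>: "\<zeta> \<in> Z \<rightarrow>\<^sub>E F Z"
    by (auto simp: coalgebra_def)
  have FZU: "F Z \<in> U"
    by (rule set_functor_obj[OF F ZU])
  have coalgF: "coalgebra U F (F Z) (Fm Z (F Z) \<zeta>)"
    unfolding coalgebra_def using FZU set_functor_mor[OF F ZU FZU \<zeta>] by blast
  then obtain h where h: "coalg_mor F Fm (F Z) (Fm Z (F Z) \<zeta>) Z \<zeta> h"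
    using terminal_coalgebraD(2)[OF Z] by blast
  then have hE: "h \<in> F Z \<rightarrow>\<^sub>E Z"
    by (simp add: coalg_mor_def)
  \<comment> \<open>Both sides of the morphism square are literally \<open>F \<zeta>\<close> after
    \<open>\<zeta>\<close>.\<close>
  have "coalg_mor F Fm Z \<zeta> (F Z) (Fm Z (F Z) \<zeta>) \<zeta>"
    using \<zeta> by (rule coalg_morI) simp
  from coalg_mor_compose[OF F coalg coalgF coalg this h]
  have id: "compose Z h \<zeta> = (\<lambda>z\<in>Z. z)"
    by (rule terminal_coalgebra_endo[OF F Z])
  fix u assume u: "u \<in> F Z"
  have "\<zeta> (h u) = Fm (F Z) Z h (Fm Z (F Z) \<zeta> u)"
    by (rule coalg_mor_apply[OF h u])
  also have "\<dots> = Fm Z Z (compose Z h \<zeta>) u"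
    using u by (simp add: set_functor_compose[OF F ZU FZU ZU \<zeta> hE] compose_eq)
  also have "\<dots> = u"
    using u by (simp add: id set_functor_id[OF F ZU])
  finally show "u \<in> \<zeta> ` Z"
    using hE u by force
qed

text \<open>A single morphism \<open>k\<close> from \<open>C\<close> back to \<open>Z\<close> is a
  left inverse of every morphism from \<open>Z\<close> to \<open>C\<close>, by uniqueness of
  endomorphisms of \<open>Z\<close>. Applying it to \<open>f x = g y\<close> cancels
  \<open>f\<close> and \<open>g\<close> at once.\<close>

lemma beh_equiv_terminal:
  assumes F: "set_functor U F Fm" and Z: "terminal_coalgebra U F Fm Z \<zeta>"
    and xy: "(x, y) \<in> beh_equiv U F Fm Z \<zeta> Z \<zeta>"
  shows "x = y"
proof -
  obtain C \<gamma> f g where C: "coalgebra U F C \<gamma>"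
    and f: "coalg_mor F Fm Z \<zeta> C \<gamma> f" and g: "coalg_mor F Fm Z \<zeta> C \<gamma> g"
    and eq: "f x = g y" and x: "x \<in> Z" and y: "y \<in> Z"
    using xy by (auto simp: beh_equiv_def)
  obtain k where k: "coalg_mor F Fm C \<gamma> Z \<zeta> k"
    using terminal_coalgebraD(2)[OF Z C] by blast
  have retract: "k (e z) = z" if "coalg_mor F Fm Z \<zeta> C \<gamma> e" "z \<in> Z" for e z
  proof -
    have "compose Z k e = (\<lambda>z\<in>Z. z)"
      using coalg_mor_compose[OF F _ C _ that(1) k] terminal_coalgebraD(1)[OF Z]
      by (simp add: C terminal_coalgebra_endo[OF F Z])
    from fun_cong[OF this, of z] that(2) show ?thesis
      by (simp add: compose_eq)
  qed
  show ?thesis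
    using retract[OF f x] retract[OF g y] eq by simp
qed

lemma mono_mor_if_inj_on:
  assumes f: "f \<in> X \<rightarrow>\<^sub>E Y" and inj: "inj_on f X"
  shows "mono_mor U X Y f"
  unfolding mono_mor_def
proof (intro conjI ballI impI f)
  fix W g h
  assume g: "g \<in> W \<rightarrow>\<^sub>E X" and h: "h \<in> W \<rightarrow>\<^sub>E X" and eq: "compose W f g = compose W f h"
  show "g = h"
  proof (rule PiE_ext[OF g h])
    fix w assume w: "w \<in> W"
    with fun_cong[OF eq, of w] have "f (g w) = f (h w)"
      by (simp add: compose_eq)
    then show "g w = h w"
      using inj g h w by (auto dest: inj_onD)
  qed
qed

text \<open>A universe without nonempty sets is no exception: there \<open>X\<close> itself is empty.\<close>

lemma inj_on_if_mono_mor: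
  assumes "X \<in> U" "mono_mor U X Y f"
  shows "inj_on f X"
proof (rule inj_onI)
  fix x y assume xy: "x \<in> X" "y \<in> X" "f x = f y"
  \<comment> \<open>Since \<open>U\<close> may contain no singleton, points are tested by constant
    maps whose domain is \<open>X\<close> itself.\<close>
  have "compose X f (\<lambda>_\<in>X. x) = compose X f (\<lambda>_\<in>X. y)"
    using xy by (auto simp: compose_def intro!: restrict_ext)
  moreover have "(\<lambda>_\<in>X. x) \<in> X \<rightarrow>\<^sub>E X" "(\<lambda>_\<in>X. y) \<in> X \<rightarrow>\<^sub>E X"
    using xy by auto
  ultimately have "(\<lambda>_\<in>X. x) = (\<lambda>_\<in>X. y)"
    using assms by (simp add: mono_mor_def)
  from fun_cong[OF this, of x] xy show "x = y"
    by simp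
qed

text \<open>Injections and monomorphisms coincide on objects of \<open>U\<close>, including
  \<open>F X\<close>, so the categorical assumption transfers to elements.\<close>

lemma preserves_monos_inj_on:
  assumes "set_functor U F Fm" "preserves_monos U F Fm" "X \<in> U" "Y \<in> U"
    and "f \<in> X \<rightarrow>\<^sub>E Y" "inj_on f X"
  shows "inj_on (Fm X Y f) (F X)"
proof (rule inj_on_if_mono_mor[OF set_functor_obj[OF assms(1,3)]])
  have "mono_mor U X Y f"
    by (rule mono_mor_if_inj_on[OF assms(5,6)])
  with assms show "mono_mor U (F X) (F Y) (Fm X Y f)"
    by (simp add: preserves_monos_def)
qed

text \<open>Injectivity means that the kernel of \<open>f\<close> is the identity on
  \<open>A\<close>, so the reindexing law at \<open>Id_on X\<close>, with \<open>f\<close> on both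
  sides, computes \<open>R\<close> at \<open>Id_on A\<close>. The equivalence serves in both
  directions: to pull a pair back to a small subset and to push it forward into
  \<open>Z\<close>.\<close>

lemma connector_Id_on_inj:
  assumes "relational_connector U F Fm R" "A \<in> U" "X \<in> U"
    and f: "f \<in> A \<rightarrow>\<^sub>E X" and inj: "inj_on f A" and uv: "u \<in> F A" "v \<in> F A"
  shows "(u, v) \<in> R A A (Id_on A) \<longleftrightarrow> (Fm A X f u, Fm A X f v) \<in> R X X (Id_on X)"
proof -
  have "(Gr A f)\<inverse> \<cdot> Id_on X \<cdot> Gr A f = Id_on A"
    using f inj by (auto simp: Gr_def dest: inj_onD)
  moreover have "R A A ((Gr A f)\<inverse> \<cdot> Id_on X \<cdot> Gr A f) =
      (Gr (F A) (Fm A X f))\<inverse> \<cdot> R X X (Id_on X) \<cdot> Gr (F A) (Fm A X f)"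
  proof -
    have "Id_on X \<subseteq> X \<times> X"
      by auto
    with assms show ?thesis
      by (simp add: relational_connector_def)
  qed
  ultimately have "R A A (Id_on A) =
      (Gr (F A) (Fm A X f))\<inverse> \<cdot> R X X (Id_on X) \<cdot> Gr (F A) (Fm A X f)"
    by simp
  with uv show ?thesis
    by (auto simp: Gr_def)
qed

lemma connector_Id_on_terminal:
  assumes F: "set_functor U F Fm" and R: "relational_connector U F Fm R"
    and sound: "similarity_sound U F Fm R" and Z: "terminal_coalgebra U F Fm Z \<zeta>"
    and uv: "(u, v) \<in> R Z Z (Id_on Z)"
  shows "u = v"
proof -
  have coalg: "coalgebra U F Z \<zeta>"
    by (rule terminal_coalgebraD[OF Z])
  then have ZU: "Z \<in> U" and \<zeta>: "\<zeta> \<in> Z \<rightarrow>\<^sub>E F Z"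
    by (auto simp: coalgebra_def)
  have rel: "is_relator U F R" and Id: "Id_on (F Z) \<subseteq> R Z Z (Id_on Z)"
    using R ZU by (auto simp: relational_connector_def)
  have "Id_on Z \<subseteq> Z \<times> Z"
    by auto
  then have "R Z Z (Id_on Z) \<subseteq> F Z \<times> F Z"
    using rel ZU by (simp add: is_relator_def)
  then obtain x y where x: "x \<in> Z" "u = \<zeta> x" and y: "y \<in> Z" "v = \<zeta> y"
    using uv terminal_coalgebra_surj[OF F Z] by blast
  \<comment> \<open>The diagonal is included because the hypothesis places \<open>(u, v)\<close> in
    \<open>R\<close> at \<open>Id_on Z\<close>, and monotonicity carries it to \<open>R\<close> at
    any larger relation.\<close>
  define r where "r = insert (x, y) (Id_on Z)"
  have r: "r \<subseteq> Z \<times> Z"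
    using x y by (auto simp: r_def)
  have "Id_on Z \<subseteq> r"
    by (auto simp: r_def)
  with r have "R Z Z (Id_on Z) \<subseteq> R Z Z r"
    using rel ZU by (simp add: is_relator_def)
  \<comment> \<open>Diagonal pairs are sent by \<open>\<zeta>\<close> to diagonal pairs, which are
    covered by \<open>Id\<close>; the added pair is sent to \<open>(u, v)\<close>.\<close>
  then have "(\<zeta> a, \<zeta> b) \<in> R Z Z r" if "(a, b) \<in> r" for a b
    using that uv Id \<zeta> x y by (auto simp: r_def)
  with r have "simulation R Z \<zeta> Z \<zeta> r"
    by (force simp: simulation_def Gr_def relcomp_unfold)
  then have "r \<subseteq> similarity R Z \<zeta> Z \<zeta>"
    by (rule similarity_greatest_simulation(2)[OF rel ZU ZU])
  then have "(x, y) \<in> beh_equiv U F Fm Z \<zeta> Z \<zeta>"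
    using sound coalg unfolding similarity_sound_def r_def by blast
  then have "x = y"
    by (rule beh_equiv_terminal[OF F Z])
  then show ?thesis
    using x y by simp
qed

theorem theorem15:
  fixes U :: "'u set set"
    and F :: "'u obj_map" and Fm :: "'u mor_map"
    and R :: "'u relator"
  assumes "set_functor U F Fm"
    and "zeta_bounded U F Fm"
    and "preserves_monos U F Fm"
    and "relational_connector U F Fm R"
    and "similarity_sound U F Fm R"
  shows "normal_relator U F R"
  unfolding normal_relator_def
proof (intro ballI equalityI subrelI)
  fix X u v
  assume X: "X \<in> U" and uv: "(u, v) \<in> R X X (Id_on X)"
  have "Id_on X \<subseteq> X \<times> X"
    by auto
  then have "R X X (Id_on X) \<subseteq> F X \<times> F X"
    using assms(4) X by (simp add: relational_connector_def is_relator_def)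
  then have FX: "u \<in> F X" "v \<in> F X"
    using uv by auto
  obtain Z \<zeta> where Z: "terminal_coalgebra U F Fm Z \<zeta>"
    and bounded: "\<forall>X\<in>U. \<forall>u \<in> F X. \<forall>v \<in> F X. \<exists>A\<in>U. A \<lesssim> Z \<and>
      (\<exists>i \<in> A \<rightarrow>\<^sub>E X. inj_on i A \<and> {u, v} \<subseteq> Fm A X i ` F A)"
    using assms(2) unfolding zeta_bounded_def by blast
  have ZU: "Z \<in> U"
    using Z by (simp add: terminal_coalgebra_def coalgebra_def)
  obtain A i where A: "A \<in> U" "A \<lesssim> Z" and i: "i \<in> A \<rightarrow>\<^sub>E X" "inj_on i A"
    and im: "{u, v} \<subseteq> Fm A X i ` F A"
    using bounded X FX by meson
  obtain a b where a: "a \<in> F A" "u = Fm A X i a" and b: "b \<in> F A" "v = Fm A X i b"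
    using im by auto
  obtain j' where j': "inj_on j' A" "j' ` A \<subseteq> Z"
    using A(2) by (auto simp: lepoll_def)
  \<comment> \<open>Restriction makes the injection extensional, hence a morphism from
    \<open>A\<close> to \<open>Z\<close>.\<close>
  define j where "j = restrict j' A"
  have j: "j \<in> A \<rightarrow>\<^sub>E Z" "inj_on j A"
    using j' by (auto simp: j_def inj_on_def)
  have "(a, b) \<in> R A A (Id_on A)"
    using uv by (simp add: connector_Id_on_inj[OF assms(4) A(1) X i a(1) b(1)] a(2) b(2))
  then have "(Fm A Z j a, Fm A Z j b) \<in> R Z Z (Id_on Z)"
    by (simp add: connector_Id_on_inj[OF assms(4) A(1) ZU j a(1) b(1)])
  then have "Fm A Z j a = Fm A Z j b"
    by (rule connector_Id_on_terminal[OF assms(1,4,5) Z])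
  \<comment> \<open>Preservation of monomorphisms enters here: it makes \<open>F j\<close>
    injective, so equality in \<open>F Z\<close> reflects back to \<open>F A\<close>.\<close>
  then have "a = b"
    using preserves_monos_inj_on[OF assms(1,3) A(1) ZU j] a(1) b(1) by (auto dest: inj_onD)
  then show "(u, v) \<in> Id_on (F X)"
    using FX a(2) b(2) by auto
next
  fix X u v
  assume "X \<in> U" "(u, v) \<in> Id_on (F X)"
  then show "(u, v) \<in> R X X (Id_on X)"
    using assms(4) unfolding relational_connector_def by blast
qed

end
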